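(* For integers $\mu\ge1$ and $n\ge1$, \[ \begin{split} \mu \sum_{\nu = 1}^\infty \frac{H_{\nu ,n} }{\nu (\nu + \mu )} &= ( - 1)^{n - 1} \sum_{j = 1}^{n - 1} ( - 1)^j H_{\mu - 1,n - j}\, \zeta (j + 1) + ( - 1)^{n - 1} \sum_{k = 1}^n ( - 1)^k\sum_{j = 1}^{n - k + 1} \binom{n-j}{k-1}\sum_{i = 1}^{\mu} \frac{H_{i - 1,j} }{i^{n - j + 1} }\\ &\quad + ( - 1)^{n - 1} \sum_{k = 1}^n ( - 1)^k\sum_{j = 1}^k \binom{n-j}{n-k}\sum_{i = 1}^{\mu} \frac{H_{i - 1,j} }{i^{n - j + 1} } + \left( 1 + ( - 1)^{n - 1} \right)H_\mu H_{\mu - 1,n} - \sum_{i = 1}^{\mu - 1} \frac{H_i}{i^n} + \zeta (n + 1). \end{split} \] In particular, for $\mu\ge1$, \[ 2\mu \sum_{\nu = 1}^\infty \frac{H_\nu }{\nu (\nu + \mu )} = H_{\mu - 1}^2 + H_{\mu - 1,2} + 2\zeta (2), \] and for $n\ge1$, \[ \sum_{\nu = 1}^\infty \frac{H_{\nu ,n} }{\nu (\nu + 1 )} = \zeta (n + 1). \]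
   Context: For integers $m\ge0$ and $n$, $H_{m,n}=\sum_{k=1}^m k^{-n}$ (with $H_{0,n}=0$) and $H_m=H_{m,1}$; $\zeta$ is the Riemann zeta function. Empty sums are zero. *)

theory Defs
  imports "HOL-Analysis.Analysis"
begin

definition gharm :: "nat \<Rightarrow> int \<Rightarrow> real" where
  "gharm m n = (\<Sum>k = 1..m. real k powi (- n))"

abbreviation harm1 :: "nat \<Rightarrow> real" where
  "harm1 m \<equiv> gharm m 1"

text \<open>
  The Riemann zeta function at natural arguments, given by its Dirichlet series. The series
  converges exactly for \<open>s \<ge> 2\<close>; no meaning is intended for \<open>s \<le> 1\<close>.
\<close>

definition zeta_nat :: "nat \<Rightarrow> real" where
  "zeta_nat s = (\<Sum>k. 1 / real (Suc k) ^ s)"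

end

theory Submission
  imports Defs
begin

text \<open>
  Write the summand \<open>\<mu> / (\<nu> (\<nu> + \<mu>))\<close> as the telescoping sum of
  \<open>1 / (\<nu> + i) - 1 / (\<nu> + i + 1)\<close> over \<open>i < \<mu>\<close>. Summation by parts in \<open>\<nu>\<close> turns the \<open>i\<close>-th
  part into the series of \<open>1 / (\<nu>^n (\<nu> + i))\<close>, which partial fractions evaluate in terms of zeta
  values and \<open>H_i / i^n\<close>. On the right-hand side, the alternating sums over \<open>k\<close> of
  binomial coefficients vanish unless \<open>j = n\<close>, so both triple sums are multiples of the sum of
  \<open>H_{i-1,n} / i\<close>, and summation by parts relates that to the sum of \<open>H_i / i^n\<close>.
\<close>

section \<open>Recurrences for the generalised harmonic numbers\<close>

lemma gharm_0 [simp]: "gharm 0 n = 0"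
  by (simp add: gharm_def)

lemma gharm_Suc: "gharm (Suc m) (int n) = gharm m (int n) + 1 / real (Suc m) ^ n"
  by (simp add: gharm_def power_int_minus divide_inverse)

lemma gharm_eq_sum: "gharm m (int n) = (\<Sum>k = 1..m. 1 / real k ^ n)"
  by (simp add: gharm_def power_int_minus divide_inverse)

lemma harm1_Suc: "harm1 (Suc m) = harm1 m + 1 / real (Suc m)"
  using gharm_Suc[of m 1] by simp

section \<open>Summation by parts in \<open>\<nu>\<close>\<close>

lemma gharm_over_n_tendsto_0:
  assumes "n \<ge> 1"
  shows "(\<lambda>N. gharm N (int n) / (real N + real c)) \<longlonglongrightarrow> 0"
proof -
  have le: "gharm N (int n) \<le> harm N" for N
  proof -
    have "1 / real k ^ n \<le> inverse (real k)" if "k \<in> {1..N}" for k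
    proof -
      have "real k ^ 1 \<le> real k ^ n"
        using that assms by (intro power_increasing) auto
      then show ?thesis using that by (simp add: divide_inverse)
    qed
    then show ?thesis unfolding gharm_eq_sum harm_def by (intro sum_mono) auto
  qed
  have ge: "0 \<le> gharm N (int n)" for N
    unfolding gharm_eq_sum by (intro sum_nonneg) auto
  \<comment> \<open>Harmonic numbers grow only like the logarithm: the bracket converges to the
    Euler-Mascheroni constant, so both summands vanish in the limit.\<close>
  have "(\<lambda>N. (harm N - ln (real N)) * (1 / real N) + ln (real N) / real N) \<longlonglongrightarrow> 0"
    using tendsto_add[OF tendsto_mult[OF euler_mascheroni_LIMSEQ lim_1_over_n] lim_ln_over_n]
    by simp
  then have lim: "(\<lambda>N. harm N / real N :: real) \<longlonglongrightarrow> 0"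
    by (simp add: diff_divide_distrib)
  show ?thesis
  proof (rule tendsto_sandwich[OF _ _ tendsto_const lim])
    have "gharm N (int n) / (real N + real c) \<le> harm N / real N" for N
    proof (cases "N = 0")
      case False
      then show ?thesis using le ge by (intro frac_le) (auto intro: order_trans)
    qed simp
    then show "eventually (\<lambda>N. gharm N (int n) / (real N + real c) \<le> harm N / real N) sequentially"
      by simp
  qed (simp add: ge)
qed

text \<open>Abel summation: the increment of \<open>gharm\<close> at \<open>Suc \<nu>\<close> is
  \<open>1 / real (Suc \<nu>) ^ n\<close>, which gives the series of the hypothesis. The boundary
  term at \<open>N\<close> tends to 0 because harmonic numbers grow sublinearly.\<close>

lemma sums_gharm_diff:
  assumes "n \<ge> 1" and "(\<lambda>\<nu>. 1 / (real (Suc \<nu>) ^ n * (real (Suc \<nu>) + real i))) sums s"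
  shows "(\<lambda>\<nu>. gharm (Suc \<nu>) (int n) *
    (1 / (real (Suc \<nu>) + real i) - 1 / (real (Suc \<nu>) + real (Suc i)))) sums s"
proof -
  let ?f = "\<lambda>\<nu>. gharm (Suc \<nu>) (int n) *
    (1 / (real (Suc \<nu>) + real i) - 1 / (real (Suc \<nu>) + real (Suc i)))"
  let ?g = "\<lambda>\<nu>. 1 / (real (Suc \<nu>) ^ n * (real (Suc \<nu>) + real i))"
  have part: "sum ?f {..<N} = sum ?g {..<N} - gharm N (int n) / (real N + real (Suc i))" for N
  proof (induction N)
    case 0
    show ?case by simp
  next
    case (Suc N)
    define u v where "u = 1 / (real (Suc N) + real i)" and "v = 1 / (real (Suc N) + real (Suc i))"
    define a p where "a = gharm N (int n)" and "p = 1 / real (Suc N) ^ n"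
    have f: "?f N = (a + p) * (u - v)" and g: "?g N = p * u"
      by (simp_all add: gharm_Suc u_def v_def a_def p_def del: of_nat_Suc)
    define S T where "S = sum ?f {..<N}" and "T = sum ?g {..<N}"
    \<comment> \<open>The old boundary denominator is the one in \<open>u\<close>, so the boundary
      term \<open>a * u\<close> cancels against the \<open>a * u\<close> in
      \<open>?f N\<close>.\<close>
    have "real N + real (Suc i) = real (Suc N) + real i"
      by simp
    then have "S = T - a * u"
      unfolding S_def T_def Suc a_def u_def by (simp del: of_nat_Suc)
    moreover have "gharm (Suc N) (int n) / (real (Suc N) + real (Suc i)) = (a + p) * v"
      by (simp add: a_def p_def v_def gharm_Suc del: of_nat_Suc)
    ultimately show ?case
      unfolding sum.lessThan_Suc f g S_def[symmetric] T_def[symmetric]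
      by (simp add: algebra_simps del: of_nat_Suc)
  qed
  show ?thesis
    unfolding sums_def part
    using tendsto_diff[OF assms(2)[unfolded sums_def] gharm_over_n_tendsto_0[OF assms(1), of "Suc i"]]
    by simp
qed

section \<open>Partial fractions and zeta values\<close>

lemma zeta_nat_sums:
  assumes "s \<ge> 2"
  shows "(\<lambda>\<nu>. 1 / real (Suc \<nu>) ^ s) sums zeta_nat s"
proof -
  have "summable (\<lambda>\<nu>. inverse (real (Suc \<nu>) ^ s))"
    using inverse_power_summable[OF assms, where 'a = real] by (subst summable_Suc_iff)
  then show ?thesis
    unfolding zeta_nat_def by (simp add: summable_sums divide_inverse)
qed

text \<open>The difference splits into \<open>i\<close> differences of consecutive shifts. The one
  with shift \<open>l\<close> telescopes in \<open>\<nu>\<close> to its first term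
  \<open>1 / real (Suc l)\<close>.\<close>

lemma sums_harm1:
  "(\<lambda>\<nu>. 1 / real (Suc \<nu>) - 1 / (real (Suc \<nu>) + real i)) sums harm1 i"
proof -
  have "(\<lambda>\<nu>. 1 / (real (Suc \<nu>) + real l) - 1 / (real (Suc \<nu>) + real (Suc l))) sums (1 / real (Suc l))"
    for l
  proof -
    have "(\<lambda>\<nu>. 1 / (real \<nu> + real (Suc l))) \<longlonglongrightarrow> 0"
      using LIMSEQ_ignore_initial_segment[OF lim_1_over_n[where 'a = real], of "Suc l"] by (simp add: add_ac)
    from telescope_sums'[OF this] show ?thesis
      by (simp add: algebra_simps)
  qed
  then have "(\<lambda>\<nu>. \<Sum>l<i. 1 / (real (Suc \<nu>) + real l) - 1 / (real (Suc \<nu>) + real (Suc l)))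
      sums (\<Sum>l<i. 1 / real (Suc l))"
    by (intro sums_sum) auto
  moreover have "(\<Sum>l<i. 1 / real (Suc l)) = harm1 i"
    by (induction i) (auto simp: harm1_Suc)
  moreover have "(\<Sum>l<i. 1 / (real (Suc \<nu>) + real l) - 1 / (real (Suc \<nu>) + real (Suc l)))
      = 1 / real (Suc \<nu>) - 1 / (real (Suc \<nu>) + real i)" for \<nu>
    using sum_lessThan_telescope'[of "\<lambda>l. 1 / (real (Suc \<nu>) + real l)" i] by simp
  ultimately show ?thesis
    by simp
qed

text \<open>Induction by the partial fraction step \<open>eq\<close>: each further factor of
  \<open>x\<close> contributes one new zeta value, flips the sign of the previous result and divides
  it by \<open>i\<close>. The base case is \<open>harm1 i / real i\<close>.\<close>

lemma sums_inverse_power_shift: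
  assumes "i \<ge> 1"
  shows "(\<lambda>\<nu>. 1 / (real (Suc \<nu>) ^ Suc m * (real (Suc \<nu>) + real i))) sums
    ((-1) ^ m * ((\<Sum>j = 1..m. (-1) ^ j * zeta_nat (j + 1) / real i ^ (Suc m - j))
      + harm1 i / real i ^ Suc m))"
proof -
  have step: "1 / (x * (x + real i)) = (1 / x - 1 / (x + real i)) / real i" if "x > 0" for x
    using that assms by (simp add: divide_simps add_pos_pos add_nonneg_eq_0_iff)
  show ?thesis
  proof (induction m)
    case 0
    show ?case
      using sums_divide[OF sums_harm1[of i], of "real i"] by (simp add: step)
  next
    case (Suc m)
    let ?Z = "\<lambda>m. \<Sum>j = 1..m. (-1) ^ j * zeta_nat (j + 1) / real i ^ (Suc m - j)"
    have eq: "1 / (x ^ Suc (Suc m) * (x + real i))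
        = (1 / x ^ (m + 2) - 1 / (x ^ Suc m * (x + real i))) / real i" if "x > 0" for x
    proof -
      have "1 / (x ^ Suc (Suc m) * (x + real i)) = 1 / (x * (x + real i)) / x ^ Suc m"
        by (simp only: power_Suc divide_divide_eq_left mult_ac)
      also have "\<dots> = (1 / x ^ (m + 2) - 1 / (x ^ Suc m * (x + real i))) / real i"
        unfolding step[OF that]
        by (simp only: diff_divide_distrib divide_divide_eq_left power_Suc add_2_eq_Suc' mult_ac)
      finally show ?thesis .
    qed
    have "(\<Sum>j = 1..m. (-1) ^ j * zeta_nat (j + 1) / real i ^ (Suc (Suc m) - j))
        = (\<Sum>j = 1..m. (-1) ^ j * zeta_nat (j + 1) / real i ^ (Suc m - j) / real i)"
      by (intro sum.cong refl) (simp add: Suc_diff_le)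
    \<comment> \<open>The new summand \<open>j = Suc m\<close> carries only the first power of
      \<open>i\<close>.\<close>
    then have Z: "?Z (Suc m) = ?Z m / real i + (-1) ^ Suc m * zeta_nat (m + 2) / real i"
      by (simp add: sum_divide_distrib)
    \<comment> \<open>Here \<open>s\<close> stands for \<open>(-1) ^ m\<close>; its square being 1
      is all that the sign bookkeeping requires.\<close>
    have alg: "(z - s * (A + h)) / x = (- s) * ((A / x + (- s) * z / x) + h / x)"
      if "s * s = 1" for s z A h x :: real
      using that unfolding divide_inverse by algebra
    have "(zeta_nat (m + 2) - (-1) ^ m * (?Z m + harm1 i / real i ^ Suc m)) / real i
        = (-1) ^ Suc m * (?Z (Suc m) + harm1 i / real i ^ Suc (Suc m))"
      unfolding Z by (simp only: alg[OF minus_one_mult_self])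
        (simp only: power_Suc mult_minus1 divide_divide_eq_left mult_ac)
    then show ?case
      using sums_divide[OF sums_diff[OF zeta_nat_sums[OF le_add2[of 2 m]] Suc], of "real i"]
      by (simp only: eq of_nat_0_less_iff zero_less_Suc)
  qed
qed

text \<open>Summing the shifted series over \<open>i < \<mu>\<close> telescopes the kernel. The
  shift \<open>i = 0\<close> yields \<open>zeta_nat (n + 1)\<close>; the other shifts yield the
  partial fraction values.\<close>

lemma sums_gharm:
  assumes "n \<ge> 1" "\<mu> \<ge> 1"
  shows "(\<lambda>\<nu>. real \<mu> * (gharm (Suc \<nu>) (int n) / (real (Suc \<nu>) * (real (Suc \<nu>) + real \<mu>)))) sums
    (zeta_nat (n + 1)
      + (-1) ^ (n - 1) * (\<Sum>j = 1..n - 1. (-1) ^ j * gharm (\<mu> - 1) (int (n - j)) * zeta_nat (j + 1))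
      + (-1) ^ (n - 1) * (\<Sum>i = 1..\<mu> - 1. harm1 i / real i ^ n))"
proof -
  obtain m where m: "n = Suc m" using assms by (cases n) auto
  obtain M where M: "\<mu> = Suc M" using assms by (cases \<mu>) auto
  \<comment> \<open>Shift 0 is separate because the partial fractions divide by \<open>i\<close>;
    there the summand is simply the reciprocal of a power with exponent
    \<open>n + 1\<close>.\<close>
  define G where "G i = (if i = 0 then zeta_nat (n + 1) else
    (-1) ^ m * ((\<Sum>j = 1..m. (-1) ^ j * zeta_nat (j + 1) / real i ^ (Suc m - j))
      + harm1 i / real i ^ Suc m))" for i
  have G: "(\<lambda>\<nu>. 1 / (real (Suc \<nu>) ^ n * (real (Suc \<nu>) + real i))) sums G i" for i
  proof (cases "i = 0")
    case True
    then show ?thesis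
      using zeta_nat_sums[of "n + 1"] assms by (simp add: G_def mult.commute)
  next
    case False
    then show ?thesis
      using sums_inverse_power_shift[of i m] unfolding G_def m by simp
  qed
  have "(\<lambda>\<nu>. \<Sum>i<\<mu>. gharm (Suc \<nu>) (int n) *
      (1 / (real (Suc \<nu>) + real i) - 1 / (real (Suc \<nu>) + real (Suc i)))) sums (\<Sum>i<\<mu>. G i)"
    using sums_gharm_diff[OF assms(1) G] by (intro sums_sum)
  moreover have "(\<Sum>i<\<mu>. gharm (Suc \<nu>) (int n) *
      (1 / (real (Suc \<nu>) + real i) - 1 / (real (Suc \<nu>) + real (Suc i))))
      = real \<mu> * (gharm (Suc \<nu>) (int n) / (real (Suc \<nu>) * (real (Suc \<nu>) + real \<mu>)))" for \<nu>
  proof -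
    have "1 / x - 1 / (x + real \<mu>) = real \<mu> / (x * (x + real \<mu>))" if "x > 0" for x
      using that by (simp add: divide_simps add_nonneg_eq_0_iff)
    from this[of "real (Suc \<nu>)"]
    have "1 / real (Suc \<nu>) - 1 / (real (Suc \<nu>) + real \<mu>)
        = real \<mu> / (real (Suc \<nu>) * (real (Suc \<nu>) + real \<mu>))"
      by simp
    then show ?thesis
      unfolding sum_distrib_left[symmetric] sum_lessThan_telescope'[of "\<lambda>i. 1 / (real (Suc \<nu>) + real i)"]
      by (simp del: of_nat_Suc)
  qed
  moreover have "(\<Sum>i<\<mu>. G i) = zeta_nat (n + 1) + (\<Sum>i = 1..M. G i)"
    unfolding M lessThan_Suc_atMost atMost_atLeast0 by (subst sum.atLeast_Suc_atMost) (auto simp: G_def)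
  moreover have "(\<Sum>i = 1..M. G i)
      = (-1) ^ m * (\<Sum>j = 1..m. (-1) ^ j * gharm M (int (n - j)) * zeta_nat (j + 1))
      + (-1) ^ m * (\<Sum>i = 1..M. harm1 i / real i ^ n)"
  proof -
    have "(\<Sum>i = 1..M. G i) = (\<Sum>i = 1..M.
        (-1) ^ m * (\<Sum>j = 1..m. (-1) ^ j * zeta_nat (j + 1) / real i ^ (n - j))
      + (-1) ^ m * (harm1 i / real i ^ n))"
      by (intro sum.cong) (auto simp: G_def m distrib_left)
    also have "\<dots> = (-1) ^ m * (\<Sum>i = 1..M. \<Sum>j = 1..m. (-1) ^ j * zeta_nat (j + 1) / real i ^ (n - j))
      + (-1) ^ m * (\<Sum>i = 1..M. harm1 i / real i ^ n)"
      by (simp only: sum.distrib sum_distrib_left)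
    \<comment> \<open>After the swap, the sum over \<open>i\<close> of
      \<open>1 / real i ^ (n - j)\<close> is a generalised harmonic number.\<close>
    also have "(\<Sum>i = 1..M. \<Sum>j = 1..m. (-1) ^ j * zeta_nat (j + 1) / real i ^ (n - j))
      = (\<Sum>j = 1..m. (-1) ^ j * gharm M (int (n - j)) * zeta_nat (j + 1))"
      unfolding gharm_eq_sum
      by (subst sum.swap) (simp add: sum_distrib_left sum_distrib_right mult_ac)
    finally show ?thesis .
  qed
  ultimately show ?thesis
    by (simp only: m M diff_Suc_1 add.assoc)
qed

section \<open>Finite sums on the right-hand side\<close>

lemma sum_gharm_by_parts:
  "(\<Sum>i = 1..Suc M. gharm (i - 1) (int n) / real i)
    = harm1 (Suc M) * gharm M (int n) - (\<Sum>i = 1..M. harm1 i / real i ^ n)"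
proof (induction M)
  case 0
  show ?case by simp
next
  case (Suc M)
  have "(\<Sum>i = 1..Suc (Suc M). gharm (i - 1) (int n) / real i)
      = (\<Sum>i = 1..Suc M. gharm (i - 1) (int n) / real i) + gharm (Suc M) (int n) / real (Suc (Suc M))"
    by simp
  \<comment> \<open>Discrete product rule: the product grows by
    \<open>gharm (Suc M) (int n) / real (Suc (Suc M))\<close> plus
    \<open>harm1 (Suc M) / real (Suc M) ^ n\<close>, and the latter is the new term of the
    subtracted sum.\<close>
  also have "\<dots> = harm1 (Suc (Suc M)) * gharm (Suc M) (int n) - (\<Sum>i = 1..Suc M. harm1 i / real i ^ n)"
    unfolding Suc harm1_Suc[of "Suc M"] gharm_Suc[of M]
    by (simp add: algebra_simps add_divide_distrib del: of_nat_Suc)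
  finally show ?case .
qed

lemma alternating_binomial: "(\<Sum>l\<le>N. (-1) ^ l * real (N choose l)) = (if N = 0 then 1 else 0)"
  using choose_alternating_sum[of N, where 'a = real] by (cases "N = 0") auto

text \<open>Since \<open>c j\<close> does not depend on \<open>k\<close>, swapping the sums leaves
  it with an alternating sum over the whole binomial row \<open>n - j\<close>. That sum vanishes
  unless the row is row 0, that is \<open>j = n\<close>.\<close>

lemma sum_alternating_binomial_upper:
  fixes c :: "nat \<Rightarrow> real"
  assumes "n \<ge> 1"
  shows "(\<Sum>k = 1..n. (-1) ^ k * (\<Sum>j = 1..k. real ((n - j) choose (n - k)) * c j)) = (-1) ^ n * c n"
proof -
  obtain N where N: "n = Suc N"
    using assms by (cases n) auto
  \<comment> \<open>Shifting \<open>j\<close> by one and adding the empty term \<open>k = 0\<close>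
    gives the shape of \<open>sum.nested_swap'\<close>. The surviving index \<open>j = n\<close>
    becomes \<open>j = N\<close>.\<close>
  have "(\<Sum>k = 1..n. (-1) ^ k * (\<Sum>j = 1..k. real ((n - j) choose (n - k)) * c j))
      = (\<Sum>k\<le>n. \<Sum>j<k. (-1) ^ k * (real ((n - Suc j) choose (n - k)) * c (Suc j)))"
    by (simp only: One_nat_def sum.atLeast1_atMost_eq sum.atMost_shift sum_distrib_left
        lessThan_0 sum.empty add_0)
  also have "\<dots> = (\<Sum>j<n. \<Sum>k = Suc j..n. (-1) ^ k * (real ((n - Suc j) choose (n - k)) * c (Suc j)))"
    by (rule sum.nested_swap')
  also have "\<dots> = (\<Sum>j<n. if j = N then (-1) ^ n * c n else 0)"
  proof (intro sum.cong refl)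
    fix j assume "j \<in> {..<n}"
    then have j: "Suc j \<le> n"
      by (simp only: lessThan_iff Suc_le_eq)
    then have zero_iff: "n - Suc j = 0 \<longleftrightarrow> j = N"
      by (simp only: N diff_Suc_Suc diff_is_0_eq Suc_le_mono order.eq_iff[of j N] simp_thms)
    have "(\<Sum>k = Suc j..n. (-1) ^ k * (real ((n - Suc j) choose (n - k)) * c (Suc j)))
        = (\<Sum>p\<le>n - Suc j. (-1) ^ (Suc j + p) *
            (real ((n - Suc j) choose (n - (Suc j + p))) * c (Suc j)))"
      unfolding sum.atLeastAtMost_shift_0[OF j] atMost_atLeast0 o_def ..
    also have "\<dots> = (\<Sum>p\<le>n - Suc j. (-1) ^ Suc j * c (Suc j) *
        ((-1) ^ p * real ((n - Suc j) choose p)))"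
    \<comment> \<open>With \<open>k = Suc j + p\<close>, the lower index is
      \<open>(n - Suc j) - p\<close>; symmetry of the row turns it into \<open>p\<close>.\<close>
    proof (intro sum.cong refl)
      fix p assume "p \<in> {..n - Suc j}"
      then have "(n - Suc j) choose p = (n - Suc j) choose (n - (Suc j + p))"
        unfolding diff_diff_left[symmetric] atMost_iff by (rule binomial_symmetric)
      then show "(-1) ^ (Suc j + p) * (real ((n - Suc j) choose (n - (Suc j + p))) * c (Suc j))
          = (-1) ^ Suc j * c (Suc j) * ((-1) ^ p * real ((n - Suc j) choose p))"
        by (simp only: power_add mult_ac)
    qed
    also have "\<dots> = (if j = N then (-1) ^ n * c n else 0)"
      unfolding sum_distrib_left[symmetric] alternating_binomial zero_iff
      by (cases "j = N") (simp_all only: N if_True if_False mult_1_right mult_zero_right simp_thms)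
    finally show "(\<Sum>k = Suc j..n. (-1) ^ k * (real ((n - Suc j) choose (n - k)) * c (Suc j)))
        = (if j = N then (-1) ^ n * c n else 0)" .
  qed
  also have "\<dots> = (-1) ^ n * c n"
    by (simp add: N)
  finally show ?thesis .
qed

text \<open>The reflection of \<open>k\<close> to \<open>n + 1 - k\<close> carries this sum to the
  previous one, at the cost of the sign \<open>(-1) ^ Suc n\<close>.\<close>

lemma sum_alternating_binomial_lower:
  fixes c :: "nat \<Rightarrow> real"
  assumes "n \<ge> 1"
  shows "(\<Sum>k = 1..n. (-1) ^ k * (\<Sum>j = 1..n - k + 1. real ((n - j) choose (k - 1)) * c j)) = - c n"
proof -
  have "(\<Sum>k = 1..n. (-1) ^ k * (\<Sum>j = 1..n - k + 1. real ((n - j) choose (k - 1)) * c j))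
      = (\<Sum>k = 1..n. (-1) ^ (n + 1 - k) * (\<Sum>j = 1..n - (n + 1 - k) + 1.
          real ((n - j) choose (n + 1 - k - 1)) * c j))"
    by (rule sum.atLeastAtMost_rev)
  also have "\<dots> = (\<Sum>k = 1..n. (-1) ^ Suc n *
      ((-1) ^ k * (\<Sum>j = 1..k. real ((n - j) choose (n - k)) * c j)))"
  proof (intro sum.cong refl)
    fix k assume "k \<in> {1..n}"
    then have k: "1 \<le> k" "k \<le> n"
      by simp_all
    have "n - (n + 1 - k) + 1 = k" "n + 1 - k - 1 = n - k"
      using k by simp_all
    moreover have "(-1 :: real) ^ Suc n = (-1) ^ (n + 1 - k) * (-1) ^ k"
      using k by (simp flip: power_add)
    ultimately show "(-1) ^ (n + 1 - k) * (\<Sum>j = 1..n - (n + 1 - k) + 1.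
          real ((n - j) choose (n + 1 - k - 1)) * c j)
        = (-1) ^ Suc n * ((-1) ^ k * (\<Sum>j = 1..k. real ((n - j) choose (n - k)) * c j))"
      by (simp only: mult.assoc left_minus_one_mult_self)
  qed
  also have "\<dots> = (-1) ^ Suc n * ((-1) ^ n * c n)"
    unfolding sum_distrib_left[symmetric] sum_alternating_binomial_upper[OF assms] ..
  also have "\<dots> = - c n"
    by simp
  finally show ?thesis .
qed

text \<open>With \<open>a = 1 / real (Suc M)\<close>, the square of \<open>harm1\<close> grows by
  \<open>2 * a * harm1 (Suc M) - a ^ 2\<close>, and the increment of \<open>gharm M 2\<close> makes
  up for \<open>a ^ 2\<close>.\<close>

lemma two_sum_harm1_over:
  "2 * (\<Sum>i = 1..M. harm1 i / real i) = (harm1 M)\<^sup>2 + gharm M 2"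
proof (induction M)
  case 0
  show ?case by simp
next
  case (Suc M)
  have "gharm (Suc M) 2 = gharm M 2 + 1 / real (Suc M) ^ 2"
    using gharm_Suc[of M 2] by simp
  with Suc show ?case
    by (simp add: harm1_Suc power2_eq_square algebra_simps add_divide_distrib del: of_nat_Suc)
qed

section \<open>The series identities\<close>

lemma gharm_series_summable:
  assumes "\<mu> \<ge> 1" "n \<ge> 1"
  shows "summable (\<lambda>\<nu>. gharm (Suc \<nu>) (int n) / (real (Suc \<nu>) * (real (Suc \<nu>) + real \<mu>)))"
  using assms(1) by (intro summable_mult_D[OF sums_summable[OF sums_gharm[OF assms(2,1)]]]) simp

text \<open>The triple sums collapse to \<open>- X\<close> and \<open>- e * X\<close>, and the
  product of harmonic numbers is \<open>X + Y\<close>. As \<open>e * e = 1\<close>, every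
  \<open>X\<close> cancels and \<open>e * Y\<close> remains, as in
  \<open>sums_gharm\<close>.\<close>

lemma gharm_series_eq:
  assumes \<mu>: "\<mu> \<ge> 1" and n: "n \<ge> 1"
  shows "real \<mu> * (\<Sum>\<nu>. gharm (Suc \<nu>) (int n) / (real (Suc \<nu>) * (real (Suc \<nu>) + real \<mu>))) =
        (-1) ^ (n - 1) *
          (\<Sum>j = 1..n - 1. (-1) ^ j * gharm (\<mu> - 1) (int (n - j)) * zeta_nat (j + 1))
      + (-1) ^ (n - 1) *
          (\<Sum>k = 1..n. (-1) ^ k *
            (\<Sum>j = 1..n - k + 1. real ((n - j) choose (k - 1)) *
              (\<Sum>i = 1..\<mu>. gharm (i - 1) (int j) / real i ^ (n - j + 1))))
      + (-1) ^ (n - 1) *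
          (\<Sum>k = 1..n. (-1) ^ k *
            (\<Sum>j = 1..k. real ((n - j) choose (n - k)) *
              (\<Sum>i = 1..\<mu>. gharm (i - 1) (int j) / real i ^ (n - j + 1))))
      + (1 + (-1) ^ (n - 1)) * harm1 \<mu> * gharm (\<mu> - 1) (int n)
      - (\<Sum>i = 1..\<mu> - 1. harm1 i / real i ^ n)
      + zeta_nat (n + 1)"
proof -
  let ?f = "\<lambda>\<nu>. gharm (Suc \<nu>) (int n) / (real (Suc \<nu>) * (real (Suc \<nu>) + real \<mu>))"
  note main = sums_gharm[OF n \<mu>]
  note summ = gharm_series_summable[OF \<mu> n]
  obtain M where M: "\<mu> = Suc M" using \<mu> by (cases \<mu>) auto
  define X where "X = (\<Sum>i = 1..\<mu>. gharm (i - 1) (int n) / real i)"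
  define Y where "Y = (\<Sum>i = 1..\<mu> - 1. harm1 i / real i ^ n)"
  define Z where "Z = (\<Sum>j = 1..n - 1. (-1) ^ j * gharm (\<mu> - 1) (int (n - j)) * zeta_nat (j + 1))"
  define e :: real where "e = (-1) ^ (n - 1)"
  have e: "e * e = 1" "(-1) ^ n = - e"
    using n by (cases n; simp add: e_def flip: power_mult_distrib)+
  have XY: "harm1 \<mu> * gharm (\<mu> - 1) (int n) = X + Y"
    using sum_gharm_by_parts[of n M] by (simp add: X_def Y_def M)
  have A: "(\<Sum>k = 1..n. (-1) ^ k *
      (\<Sum>j = 1..n - k + 1. real ((n - j) choose (k - 1)) *
        (\<Sum>i = 1..\<mu>. gharm (i - 1) (int j) / real i ^ (n - j + 1)))) = - X"
    \<comment> \<open>At the surviving \<open>j = n\<close> the exponent \<open>n - j + 1\<close> is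
      1, so the inner sum is \<open>X\<close>.\<close>
    by (subst sum_alternating_binomial_lower[OF n]) (simp add: X_def)
  have B: "(\<Sum>k = 1..n. (-1) ^ k *
      (\<Sum>j = 1..k. real ((n - j) choose (n - k)) *
        (\<Sum>i = 1..\<mu>. gharm (i - 1) (int j) / real i ^ (n - j + 1)))) = - e * X"
    by (subst sum_alternating_binomial_upper[OF n]) (simp add: X_def e(2))
  have "e * (- X) + e * (- e * X) + (1 + e) * (harm1 \<mu> * gharm (\<mu> - 1) (int n)) - Y
      = (1 - e * e) * X + e * Y"
    unfolding XY by (simp add: algebra_simps)
  then have "e * Y = e * (- X) + e * (- e * X) + (1 + e) * harm1 \<mu> * gharm (\<mu> - 1) (int n) - Y"
    by (simp add: e(1) mult.assoc)
  moreover have "real \<mu> * suminf ?f = zeta_nat (n + 1)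
      + e * Z + e * Y"
    unfolding e_def Y_def Z_def
    by (rule trans[OF suminf_mult[OF summ, symmetric] sums_unique[OF main, symmetric]])
  ultimately show ?thesis
    unfolding A B e_def[symmetric] Y_def[symmetric] Z_def[symmetric]
    by (simp only: add_ac diff_conv_add_uminus)
qed

text \<open>For \<open>n = 1\<close> the zeta sum in \<open>sums_gharm\<close> is empty and the sign
  is 1; doubling the remaining sum of \<open>harm1 i / real i\<close> produces the square.\<close>

lemma harm1_series_eq:
  assumes \<mu>: "\<mu> \<ge> 1"
  shows "2 * real \<mu> * (\<Sum>\<nu>. harm1 (Suc \<nu>) / (real (Suc \<nu>) * (real (Suc \<nu>) + real \<mu>))) =
    (harm1 (\<mu> - 1))\<^sup>2 + gharm (\<mu> - 1) 2 + 2 * zeta_nat 2"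
proof -
  let ?f = "\<lambda>\<nu>. harm1 (Suc \<nu>) / (real (Suc \<nu>) * (real (Suc \<nu>) + real \<mu>))"
  have main: "(\<lambda>\<nu>. real \<mu> * ?f \<nu>) sums (zeta_nat 2 + (\<Sum>i = 1..\<mu> - 1. harm1 i / real i))"
    using sums_gharm[of 1 \<mu>] \<mu> by (simp add: numeral_2_eq_2)
  have "summable ?f"
    using \<mu> by (intro summable_mult_D[OF sums_summable[OF main]]) simp
  from trans[OF suminf_mult[OF this, symmetric] sums_unique[OF main, symmetric]]
  have "real \<mu> * suminf ?f = zeta_nat 2 + (\<Sum>i = 1..\<mu> - 1. harm1 i / real i)" .
  then show ?thesis
    using two_sum_harm1_over[of "\<mu> - 1"] by (simp only: mult.assoc distrib_left add.commute)
qed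

text \<open>For \<open>\<mu> = 1\<close> only the shift \<open>i = 0\<close> occurs, so all terms
  but the zeta value are empty.\<close>

lemma gharm_series_one:
  assumes "n \<ge> 1"
  shows "(\<Sum>\<nu>. gharm (Suc \<nu>) (int n) / (real (Suc \<nu>) * (real (Suc \<nu>) + 1))) = zeta_nat (n + 1)"
  using sums_unique[OF sums_gharm[OF assms order.refl]] by simp

theorem theorem5p4:
  shows "(\<forall>\<mu> n :: nat. \<mu> \<ge> 1 \<longrightarrow> n \<ge> 1 \<longrightarrow>
      summable (\<lambda>\<nu>. gharm (Suc \<nu>) (int n) / (real (Suc \<nu>) * (real (Suc \<nu>) + real \<mu>))) \<and>
      real \<mu> * (\<Sum>\<nu>. gharm (Suc \<nu>) (int n) / (real (Suc \<nu>) * (real (Suc \<nu>) + real \<mu>))) =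
        (-1) ^ (n - 1) *
          (\<Sum>j = 1..n - 1. (-1) ^ j * gharm (\<mu> - 1) (int (n - j)) * zeta_nat (j + 1))
      + (-1) ^ (n - 1) *
          (\<Sum>k = 1..n. (-1) ^ k *
            (\<Sum>j = 1..n - k + 1. real ((n - j) choose (k - 1)) *
              (\<Sum>i = 1..\<mu>. gharm (i - 1) (int j) / real i ^ (n - j + 1))))
      + (-1) ^ (n - 1) *
          (\<Sum>k = 1..n. (-1) ^ k *
            (\<Sum>j = 1..k. real ((n - j) choose (n - k)) *
              (\<Sum>i = 1..\<mu>. gharm (i - 1) (int j) / real i ^ (n - j + 1))))
      + (1 + (-1) ^ (n - 1)) * harm1 \<mu> * gharm (\<mu> - 1) (int n)
      - (\<Sum>i = 1..\<mu> - 1. harm1 i / real i ^ n)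
      + zeta_nat (n + 1))
    \<and> (\<forall>\<mu> :: nat. \<mu> \<ge> 1 \<longrightarrow>
      2 * real \<mu> * (\<Sum>\<nu>. harm1 (Suc \<nu>) / (real (Suc \<nu>) * (real (Suc \<nu>) + real \<mu>))) =
        (harm1 (\<mu> - 1))\<^sup>2 + gharm (\<mu> - 1) 2 + 2 * zeta_nat 2)
    \<and> (\<forall>n :: nat. n \<ge> 1 \<longrightarrow>
      (\<Sum>\<nu>. gharm (Suc \<nu>) (int n) / (real (Suc \<nu>) * (real (Suc \<nu>) + 1))) = zeta_nat (n + 1))"
  by (intro conjI allI impI gharm_series_summable gharm_series_eq harm1_series_eq gharm_series_one)

end
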